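(* If $\mathrm{AIRAIndL}(\mathrel{\perp\!\!\!\perp})$ is complete (i.e. $\Sigma \models \vec{x} \perp \vec{y}$ implies $\Sigma \vdash \vec{x} \perp \vec{y}$ for all sets $\Sigma$ of atoms), then $\mathrel{\perp\!\!\!\perp}$ is federated and admits an algebraic point.
   Context: Let $(\mathbf{K}, \preccurlyeq)$ be an AEC with amalgamation, joint embedding and arbitrarily large models, with monster model $\mathfrak{M}$, and $\mathrel{\perp\!\!\!\perp}$ a pre-independence relation on bounded subsets of $\mathfrak{M}$ (Invariance, Existence, Monotonicity, Base Monotonicity, Symmetry, Transitivity, Normality, Finite Character, Anti-Reflexivity). Semantics: $\mathfrak{M} \models_s \vec{x} \perp \vec{y}$ iff $s(\vec{x}) \mathrel{\perp\!\!\!\perp}_{\emptyset} s(\vec{y})$; $\Sigma \models \phi$ iff every assignment into $\mathfrak{M}$ satisfying $\Sigma$ satisfies $\phi$. Deductive system: ($a_3$) $\vec{x} \perp \emptyset$; ($b_3$) $\vec{x} \perp \vec{y} \Rightarrow \vec{y} \perp \vec{x}$; ($c_3$) $\vec{x} \perp \vec{y}\vec{z} \Rightarrow \vec{x} \perp \vec{y}$; ($d_3$) $\vec{x} \perp \vec{y}$ and $\vec{x}\vec{y} \perp \vec{z} \Rightarrow \vec{x} \perp \vec{y}\vec{z}$; ($e_3$) $x \perp x \Rightarrow x \perp \vec{y}$; ($f_3$) permutation of either side; ($g_3$) $\vec{x} y \vec{z} \perp \vec{w} \Rightarrow \vec{x} y y \vec{z} \perp \vec{w}$. For $n\ge1$,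 an injective $\mathrel{\perp\!\!\!\perp}$-independent sequence $(a_i \mid i<n)$ (i.e. $(a_i \mid i<j) \mathrel{\perp\!\!\!\perp}_\emptyset a_j$ for all $j$) is federated if some $d$ is not $\mathrel{\perp\!\!\!\perp}_\emptyset$-independent from $a_0\cdots a_{n-1}$ but $d \mathrel{\perp\!\!\!\perp}_\emptyset (a_i \mid i<n)-a_j$ for each $j<n$; $\mathrel{\perp\!\!\!\perp}$ is federated if such sequences exist for every $n \ge 1$. An algebraic point is $e$ with $e \mathrel{\perp\!\!\!\perp}_\emptyset e$. *)

theory Defs
  imports Main "HOL-Library.Multiset"
begin

unbundle cardinal_syntax

section \<open>Structures\<close>

record ('f, 'r) vocabulary =
  funs :: "'f set"
  rels :: "'r set"
  farity :: "'f \<Rightarrow> nat"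
  rarity :: "'r \<Rightarrow> nat"

record ('f, 'r, 'a) struct =
  universe :: "'a set"
  fint :: "'f \<Rightarrow> 'a list \<Rightarrow> 'a"
  rint :: "'r \<Rightarrow> 'a list set"

definition tuples :: "'a set \<Rightarrow> nat \<Rightarrow> 'a list set" where
  "tuples X n = {xs. length xs = n \<and> set xs \<subseteq> X}"

text \<open>Interpretations are normalised outside the vocabulary and outside the universe, so that
  equality of records is equality of structures.\<close>

definition structure_of :: "('f, 'r) vocabulary \<Rightarrow> ('f, 'r, 'a) struct \<Rightarrow> bool" where
  "structure_of \<tau> A \<longleftrightarrow>
     universe A \<noteq> {} \<and>
     (\<forall>f xs. if f \<in> funs \<tau> \<and> xs \<in> tuples (universe A) (farity \<tau> f)
             then fint A f xs \<in> universe A else fint A f xs = undefined) \<and>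
     (\<forall>r. if r \<in> rels \<tau> then rint A r \<subseteq> tuples (universe A) (rarity \<tau> r) else rint A r = {})"

definition substructure ::
    "('f, 'r) vocabulary \<Rightarrow> ('f, 'r, 'a) struct \<Rightarrow> ('f, 'r, 'a) struct \<Rightarrow> bool" where
  "substructure \<tau> A B \<longleftrightarrow>
     universe A \<subseteq> universe B \<and>
     (\<forall>f\<in>funs \<tau>. \<forall>xs\<in>tuples (universe A) (farity \<tau> f). fint A f xs = fint B f xs) \<and>
     (\<forall>r\<in>rels \<tau>. rint A r = rint B r \<inter> tuples (universe A) (rarity \<tau> r))"

definition isomorphism ::
    "('f, 'r) vocabulary \<Rightarrow> ('a \<Rightarrow> 'a) \<Rightarrow> ('f, 'r, 'a) struct \<Rightarrow> ('f, 'r, 'a) struct \<Rightarrow> bool" where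
  "isomorphism \<tau> h A B \<longleftrightarrow>
     bij_betw h (universe A) (universe B) \<and>
     (\<forall>f\<in>funs \<tau>. \<forall>xs\<in>tuples (universe A) (farity \<tau> f). h (fint A f xs) = fint B f (map h xs)) \<and>
     (\<forall>r\<in>rels \<tau>. \<forall>xs\<in>tuples (universe A) (rarity \<tau> r). xs \<in> rint A r \<longleftrightarrow> map h xs \<in> rint B r)"

text \<open>The choice of value in \<open>fint\<close> is unambiguous whenever \<open>\<C>\<close> is a chain of substructures.\<close>

definition union_struct ::
    "('f, 'r) vocabulary \<Rightarrow> ('f, 'r, 'a) struct set \<Rightarrow> ('f, 'r, 'a) struct" where
  "union_struct \<tau> \<C> =
     \<lparr>universe = (\<Union>A\<in>\<C>. universe A),
      fint = (\<lambda>f xs. if f \<in> funs \<tau> \<and> xs \<in> tuples (\<Union>A\<in>\<C>. universe A) (farity \<tau> f)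
                     then (SOME y. \<exists>A\<in>\<C>. set xs \<subseteq> universe A \<and> y = fint A f xs) else undefined),
      rint = (\<lambda>r. \<Union>A\<in>\<C>. rint A r)\<rparr>"


section \<open>Abstract elementary classes\<close>

text \<open>The type \<open>'a\<close> plays the role of the set-theoretic universe: a class of structures is a set of
  structures whose universes are subsets of \<open>'a\<close>, and the cardinals under consideration are those
  of subsets of \<open>'a\<close>.\<close>

definition LS_bound ::
    "('f, 'r, 'a) struct set \<Rightarrow> (('f, 'r, 'a) struct \<Rightarrow> ('f, 'r, 'a) struct \<Rightarrow> bool) \<Rightarrow> 'a set \<Rightarrow> bool"
  where
  "LS_bound K le L \<longleftrightarrow>
     infinite L \<and>
     (\<forall>A\<in>K. \<forall>X. X \<subseteq> universe A \<longrightarrow>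
        (\<exists>B\<in>K. le B A \<and> X \<subseteq> universe B \<and> |universe B| \<le>o |X| +c |L| ))"

text \<open>Since repetitions in an increasing chain \<open>(A\<^sub>i | i < \<delta>)\<close> do not affect its union, such a chain
  is given by the set \<open>\<C>\<close> of its members, which is well-ordered by \<open>le\<close>. The strict bound on the
  Loewenheim-Skolem number keeps the axiom from being trivially satisfied in the type \<open>'a\<close>.\<close>

locale AEC =
  fixes \<tau> :: "('f, 'r) vocabulary"
    and K :: "('f, 'r, 'a) struct set"
    and le :: "('f, 'r, 'a) struct \<Rightarrow> ('f, 'r, 'a) struct \<Rightarrow> bool"
  assumes K_structures: "A \<in> K \<Longrightarrow> structure_of \<tau> A"
    and le_in_K: "le A B \<Longrightarrow> A \<in> K \<and> B \<in> K"
    and K_iso_closed: "A \<in> K \<Longrightarrow> structure_of \<tau> B \<Longrightarrow> isomorphism \<tau> h A B \<Longrightarrow> B \<in> K"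
    and le_iso_closed: "le A B \<Longrightarrow> structure_of \<tau> A' \<Longrightarrow> structure_of \<tau> B' \<Longrightarrow>
      isomorphism \<tau> h A A' \<Longrightarrow> isomorphism \<tau> h B B' \<Longrightarrow> le A' B'"
    and le_substructure: "le A B \<Longrightarrow> substructure \<tau> A B"
    and le_refl: "A \<in> K \<Longrightarrow> le A A"
    and le_antisym: "le A B \<Longrightarrow> le B A \<Longrightarrow> A = B"
    and le_trans: "le A B \<Longrightarrow> le B C \<Longrightarrow> le A C"
    and chains: "\<C> \<noteq> {} \<Longrightarrow> \<C> \<subseteq> K \<Longrightarrow>
      well_order_on \<C> {(A, B). A \<in> \<C> \<and> B \<in> \<C> \<and> le A B} \<Longrightarrow>
        union_struct \<tau> \<C> \<in> K \<and>
        (\<forall>A\<in>\<C>. le A (union_struct \<tau> \<C>)) \<and>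
        (\<forall>B\<in>K. (\<forall>A\<in>\<C>. le A B) \<longrightarrow> le (union_struct \<tau> \<C>) B)"
    and coherence: "le A C \<Longrightarrow> le B C \<Longrightarrow> substructure \<tau> A B \<Longrightarrow> le A B"
    and Loewenheim_Skolem: "\<exists>L. LS_bound K le L \<and> |L| <o |UNIV :: 'a set|"

definition K_embedding ::
    "('f, 'r) vocabulary \<Rightarrow> (('f, 'r, 'a) struct \<Rightarrow> ('f, 'r, 'a) struct \<Rightarrow> bool) \<Rightarrow>
     ('a \<Rightarrow> 'a) \<Rightarrow> ('f, 'r, 'a) struct \<Rightarrow> ('f, 'r, 'a) struct \<Rightarrow> bool" where
  "K_embedding \<tau> le h A B \<longleftrightarrow> (\<exists>A'. le A' B \<and> isomorphism \<tau> h A A')"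

definition amalgamation ::
    "('f, 'r) vocabulary \<Rightarrow> ('f, 'r, 'a) struct set \<Rightarrow>
     (('f, 'r, 'a) struct \<Rightarrow> ('f, 'r, 'a) struct \<Rightarrow> bool) \<Rightarrow> bool" where
  "amalgamation \<tau> K le \<longleftrightarrow>
     (\<forall>A B C. le A B \<and> le A C \<longrightarrow>
        (\<exists>D\<in>K. \<exists>g h. K_embedding \<tau> le g B D \<and> K_embedding \<tau> le h C D \<and> (\<forall>x\<in>universe A. g x = h x)))"

definition joint_embedding ::
    "('f, 'r) vocabulary \<Rightarrow> ('f, 'r, 'a) struct set \<Rightarrow>
     (('f, 'r, 'a) struct \<Rightarrow> ('f, 'r, 'a) struct \<Rightarrow> bool) \<Rightarrow> bool" where
  "joint_embedding \<tau> K le \<longleftrightarrow>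
     (\<forall>A\<in>K. \<forall>B\<in>K. \<exists>C\<in>K. \<exists>g h. K_embedding \<tau> le g A C \<and> K_embedding \<tau> le h B C)"

definition arbitrarily_large_models :: "('f, 'r, 'a) struct set \<Rightarrow> bool" where
  "arbitrarily_large_models K \<longleftrightarrow> (\<forall>X :: 'a set. \<exists>A\<in>K. |X| \<le>o |universe A| )"

text \<open>A monster model is \<open>\<kappa>\<close>-universal and strongly \<open>\<kappa>\<close>-model-homogeneous for a cardinal \<open>\<kappa>\<close> above
  the Loewenheim-Skolem number; bounded means of cardinality less than \<open>\<kappa>\<close>.\<close>

definition monster_model ::
    "('f, 'r) vocabulary \<Rightarrow> ('f, 'r, 'a) struct set \<Rightarrow>
     (('f, 'r, 'a) struct \<Rightarrow> ('f, 'r, 'a) struct \<Rightarrow> bool) \<Rightarrow> 'a rel \<Rightarrow> ('f, 'r, 'a) struct \<Rightarrow> bool" where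
  "monster_model \<tau> K le \<kappa> M \<longleftrightarrow>
     Card_order \<kappa> \<and> (\<exists>L. LS_bound K le L \<and> |L| <o \<kappa>) \<and>
     M \<in> K \<and>
     (\<forall>A\<in>K. |universe A| <o \<kappa> \<longrightarrow> (\<exists>h. K_embedding \<tau> le h A M)) \<and>
     (\<forall>A B h. le A M \<and> le B M \<and> |universe A| <o \<kappa> \<and> |universe B| <o \<kappa> \<and> isomorphism \<tau> h A B \<longrightarrow>
        (\<exists>g. isomorphism \<tau> g M M \<and> (\<forall>x\<in>universe A. g x = h x)))"

definition bounded_subset :: "'a rel \<Rightarrow> ('f, 'r, 'a) struct \<Rightarrow> 'a set \<Rightarrow> bool" where
  "bounded_subset \<kappa> M A \<longleftrightarrow> A \<subseteq> universe M \<and> |A| <o \<kappa>"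


section \<open>Independence\<close>

text \<open>\<open>ind A C B\<close> reads: \<open>A\<close> is independent from \<open>B\<close> over \<open>C\<close>.\<close>

locale pre_independence =
  fixes \<tau> :: "('f, 'r) vocabulary"
    and \<kappa> :: "'a rel"
    and M :: "('f, 'r, 'a) struct"
    and ind :: "'a set \<Rightarrow> 'a set \<Rightarrow> 'a set \<Rightarrow> bool"
  assumes invariance: "bounded_subset \<kappa> M A \<Longrightarrow> bounded_subset \<kappa> M B \<Longrightarrow> bounded_subset \<kappa> M C \<Longrightarrow>
      isomorphism \<tau> h M M \<Longrightarrow> ind A C B \<Longrightarrow> ind (h ` A) (h ` C) (h ` B)"
    and existence: "bounded_subset \<kappa> M A \<Longrightarrow> bounded_subset \<kappa> M C \<Longrightarrow> ind A C C"
    and monotonicity: "bounded_subset \<kappa> M A \<Longrightarrow> bounded_subset \<kappa> M B \<Longrightarrow> bounded_subset \<kappa> M C \<Longrightarrow>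
      ind A C B \<Longrightarrow> A' \<subseteq> A \<Longrightarrow> B' \<subseteq> B \<Longrightarrow> ind A' C B'"
    and base_monotonicity: "bounded_subset \<kappa> M A \<Longrightarrow> bounded_subset \<kappa> M B \<Longrightarrow> D \<subseteq> C \<Longrightarrow> C \<subseteq> B \<Longrightarrow>
      ind A D B \<Longrightarrow> ind A C B"
    and symmetry: "bounded_subset \<kappa> M A \<Longrightarrow> bounded_subset \<kappa> M B \<Longrightarrow> bounded_subset \<kappa> M C \<Longrightarrow>
      ind A C B \<Longrightarrow> ind B C A"
    and transitivity: "bounded_subset \<kappa> M A \<Longrightarrow> bounded_subset \<kappa> M B \<Longrightarrow> D \<subseteq> C \<Longrightarrow> C \<subseteq> B \<Longrightarrow>
      ind B C A \<Longrightarrow> ind C D A \<Longrightarrow> ind B D A"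
    and normality: "bounded_subset \<kappa> M A \<Longrightarrow> bounded_subset \<kappa> M B \<Longrightarrow> bounded_subset \<kappa> M C \<Longrightarrow>
      ind A C B \<Longrightarrow> ind (A \<union> C) C B"
    and finite_character: "bounded_subset \<kappa> M A \<Longrightarrow> bounded_subset \<kappa> M B \<Longrightarrow> bounded_subset \<kappa> M C \<Longrightarrow>
      (\<And>A\<^sub>0. finite A\<^sub>0 \<Longrightarrow> A\<^sub>0 \<subseteq> A \<Longrightarrow> ind A\<^sub>0 C B) \<Longrightarrow> ind A C B"
    and anti_reflexivity: "bounded_subset \<kappa> M A \<Longrightarrow> bounded_subset \<kappa> M B \<Longrightarrow> bounded_subset \<kappa> M C \<Longrightarrow>
      ind A C A \<Longrightarrow> ind A C B"

definition independent_seq ::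
    "('a set \<Rightarrow> 'a set \<Rightarrow> 'a set \<Rightarrow> bool) \<Rightarrow> nat \<Rightarrow> (nat \<Rightarrow> 'a) \<Rightarrow> bool" where
  "independent_seq ind n a \<longleftrightarrow> (\<forall>j<n. ind (a ` {..<j}) {} {a j})"

definition federated_seq ::
    "('f, 'r, 'a) struct \<Rightarrow> ('a set \<Rightarrow> 'a set \<Rightarrow> 'a set \<Rightarrow> bool) \<Rightarrow> nat \<Rightarrow> (nat \<Rightarrow> 'a) \<Rightarrow> bool" where
  "federated_seq M ind n a \<longleftrightarrow>
     a ` {..<n} \<subseteq> universe M \<and> inj_on a {..<n} \<and> independent_seq ind n a \<and>
     (\<exists>d\<in>universe M. \<not> ind {d} {} (a ` {..<n}) \<and> (\<forall>j<n. ind {d} {} (a ` ({..<n} - {j}))))"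

definition federated ::
    "('f, 'r, 'a) struct \<Rightarrow> ('a set \<Rightarrow> 'a set \<Rightarrow> 'a set \<Rightarrow> bool) \<Rightarrow> bool" where
  "federated M ind \<longleftrightarrow> (\<forall>n\<ge>1. \<exists>a. federated_seq M ind n a)"

definition algebraic_point ::
    "('f, 'r, 'a) struct \<Rightarrow> ('a set \<Rightarrow> 'a set \<Rightarrow> 'a set \<Rightarrow> bool) \<Rightarrow> 'a \<Rightarrow> bool" where
  "algebraic_point M ind e \<longleftrightarrow> e \<in> universe M \<and> ind {e} {} {e}"


section \<open>Atomic independence logic\<close>

type_synonym var = nat

datatype atom = Indep "var list" "var list"  (infix \<open>\<bottom>\<close> 60)

fun satisfies :: "('a set \<Rightarrow> 'a set \<Rightarrow> 'a set \<Rightarrow> bool) \<Rightarrow> (var \<Rightarrow> 'a) \<Rightarrow> atom \<Rightarrow> bool" where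
  "satisfies ind s (xs \<bottom> ys) \<longleftrightarrow> ind (s ` set xs) {} (s ` set ys)"

definition entails ::
    "('f, 'r, 'a) struct \<Rightarrow> ('a set \<Rightarrow> 'a set \<Rightarrow> 'a set \<Rightarrow> bool) \<Rightarrow> atom set \<Rightarrow> atom \<Rightarrow> bool" where
  "entails M ind \<Sigma> \<phi> \<longleftrightarrow>
     (\<forall>s. range s \<subseteq> universe M \<and> (\<forall>\<psi>\<in>\<Sigma>. satisfies ind s \<psi>) \<longrightarrow> satisfies ind s \<phi>)"

inductive derives :: "atom set \<Rightarrow> atom \<Rightarrow> bool"  (infix \<open>\<turnstile>\<close> 50) for \<Sigma> :: "atom set" where
  premise: "\<phi> \<in> \<Sigma> \<Longrightarrow> \<Sigma> \<turnstile> \<phi>"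
| a3: "\<Sigma> \<turnstile> xs \<bottom> []"
| b3: "\<Sigma> \<turnstile> xs \<bottom> ys \<Longrightarrow> \<Sigma> \<turnstile> ys \<bottom> xs"
| c3: "\<Sigma> \<turnstile> xs \<bottom> (ys @ zs) \<Longrightarrow> \<Sigma> \<turnstile> xs \<bottom> ys"
| d3: "\<Sigma> \<turnstile> xs \<bottom> ys \<Longrightarrow> \<Sigma> \<turnstile> (xs @ ys) \<bottom> zs \<Longrightarrow> \<Sigma> \<turnstile> xs \<bottom> (ys @ zs)"
| e3: "\<Sigma> \<turnstile> [x] \<bottom> [x] \<Longrightarrow> \<Sigma> \<turnstile> [x] \<bottom> ys"
| f3: "\<Sigma> \<turnstile> xs \<bottom> ys \<Longrightarrow> mset xs' = mset xs \<Longrightarrow> mset ys' = mset ys \<Longrightarrow> \<Sigma> \<turnstile> xs' \<bottom> ys'"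
| g3: "\<Sigma> \<turnstile> (xs @ [y] @ zs) \<bottom> ws \<Longrightarrow> \<Sigma> \<turnstile> (xs @ [y, y] @ zs) \<bottom> ws"

definition AIRAIndL_complete ::
    "('f, 'r, 'a) struct \<Rightarrow> ('a set \<Rightarrow> 'a set \<Rightarrow> 'a set \<Rightarrow> bool) \<Rightarrow> bool" where
  "AIRAIndL_complete M ind \<longleftrightarrow>
     (\<forall>\<Sigma> xs ys. entails M ind \<Sigma> (xs \<bottom> ys) \<longrightarrow> \<Sigma> \<turnstile> xs \<bottom> ys)"

end

theory Submission
  imports Defs
begin

text \<open>Completeness turns every underivable atom into an assignment into the monster model that
  satisfies the premises and falsifies the atom. Underivability is shown with toy independence
  relations on sets of variables that respect all rules: disjointness outside one distinguished
  variable for the algebraic point, and the matroid whose only circuit is \<open>{0..n}\<close> for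
  federation. Injectivity of the federated sequence is automatic: a repetition would make the whole
  sequence equal, as a set, to one of its proper subsequences.\<close>

text \<open>\<open>ind\<close> need only respect the rules, so toy relations on variables qualify,
  with \<open>s = id\<close>. Permutation and duplication of variables preserve truth because
  satisfaction only sees sets of values.\<close>

lemma derives_sound:
  assumes "\<Sigma> \<turnstile> \<phi>"
    and "\<And>\<psi>. \<psi> \<in> \<Sigma> \<Longrightarrow> satisfies ind s \<psi>"
    and empty: "\<And>A. ind A {} {}"
    and sym: "\<And>A B. ind A {} B \<Longrightarrow> ind B {} A"
    and mono: "\<And>A B C. ind A {} (B \<union> C) \<Longrightarrow> ind A {} B"
    and exchange: "\<And>A B C. ind A {} B \<Longrightarrow> ind (A \<union> B) {} C \<Longrightarrow> ind A {} (B \<union> C)"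
    and algebraic: "\<And>a B. ind {a} {} {a} \<Longrightarrow> ind {a} {} B"
  shows "satisfies ind s \<phi>"
  using assms(1)
proof (induction rule: derives.induct)
  case (premise \<phi>)
  then show ?case by (rule assms(2))
next
  case (a3 xs)
  show ?case by (simp add: empty)
next
  case (b3 xs ys)
  then show ?case by (simp add: sym)
next
  case (c3 xs ys zs)
  then show ?case by (auto simp: image_Un intro: mono)
next
  case (d3 xs ys zs)
  then show ?case by (simp add: image_Un exchange)
next
  case (e3 x ys)
  then show ?case by (simp add: algebraic)
next
  case (f3 xs ys xs' ys')
  then show ?case by (metis satisfies.simps mset_eq_setD)
next
  case (g3 xs y zs ws)
  then show ?case by simp
qed

lemma countermodel_if_complete:
  assumes "AIRAIndL_complete M ind" and "\<not> \<Sigma> \<turnstile> xs \<bottom> ys"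
  obtains s where "range s \<subseteq> universe M" and "\<forall>\<psi>\<in>\<Sigma>. satisfies ind s \<psi>"
    and "\<not> satisfies ind s (xs \<bottom> ys)"
proof -
  from assms have "\<not> entails M ind \<Sigma> (xs \<bottom> ys)"
    unfolding AIRAIndL_complete_def by blast
  then show ?thesis
    unfolding entails_def using that by blast
qed

text \<open>Only \<open>x\<close> is independent from itself under \<open>?R\<close>, and it is
  independent from every set, which is what \<open>e3\<close> demands.\<close>

lemma algebraic_variable_not_derives:
  assumes "x \<noteq> y"
  shows "\<not> {[x] \<bottom> [x]} \<turnstile> [y] \<bottom> [y]"
proof
  let ?R = "\<lambda>A (C :: var set) B. A \<inter> B \<subseteq> {x}"
  assume "{[x] \<bottom> [x]} \<turnstile> [y] \<bottom> [y]"
  then have "satisfies ?R id ([y] \<bottom> [y])"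
    by (rule derives_sound) auto
  with assms show False by simp
qed

text \<open>The variables \<open>0, \<dots>, n - 1\<close> stand for the sequence and the variable \<open>n\<close> for the point that
  depends on it.\<close>

definition federation_atoms :: "nat \<Rightarrow> atom set" where
  "federation_atoms n =
     {[0..<j] \<bottom> [j] | j. j < n} \<union> {[n] \<bottom> filter (\<lambda>i. i \<noteq> j) [0..<n] | j. j < n}"

text \<open>Each premise misses a point of \<open>{..n}\<close>: \<open>n\<close> for the sequence
  atoms, \<open>j\<close> for the others. The conclusion covers all of it. Exchange holds because
  the covering condition depends only on the union of the two sides.\<close>

lemma federation_atoms_not_derives:
  assumes "1 \<le> n"
  shows "\<not> federation_atoms n \<turnstile> [n] \<bottom> [0..<n]"
proof
  let ?R = "\<lambda>A (C :: var set) B. A = {} \<or> B = {} \<or> (A \<inter> B = {} \<and> \<not> {..n} \<subseteq> A \<union> B)"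
  assume "federation_atoms n \<turnstile> [n] \<bottom> [0..<n]"
  then have "satisfies ?R id ([n] \<bottom> [0..<n])"
  proof (rule derives_sound)
    fix \<psi> assume "\<psi> \<in> federation_atoms n"
    then consider j where "j < n" "\<psi> = [0..<j] \<bottom> [j]"
      | j where "j < n" "\<psi> = [n] \<bottom> filter (\<lambda>i. i \<noteq> j) [0..<n]"
      unfolding federation_atoms_def by blast
    then show "satisfies ?R id \<psi>"
    proof cases
      case 1
      then have "n \<in> {..n} - ({..<j} \<union> {j})" by simp
      with 1 show ?thesis by auto
    next
      case 2
      then have "j \<in> {..n} - ({n} \<union> {i. i < n \<and> i \<noteq> j})" by simp
      then have "\<not> {..n} \<subseteq> {n} \<union> {i. i < n \<and> i \<noteq> j}" by blast
      with 2 show ?thesis by auto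
    qed
  next
    fix A B C assume "?R A {} B" "?R (A \<union> B) {} C"
    then show "?R A {} (B \<union> C)"
      by (cases "A = {} \<or> B = {} \<or> C = {}")
        (auto simp: Int_Un_distrib Int_Un_distrib2 Un_assoc)
  next
    fix A B C assume "?R A {} (B \<union> C)"
    then show "?R A {} B" by (elim disjE conjE) (simp_all add: Int_Un_distrib, metis Un_assoc le_supI1)
  next
    fix A B assume "?R A {} B"
    then show "?R B {} A" by (elim disjE conjE) (simp_all add: Int_commute Un_commute)
  \<comment> \<open>The condition behind \<open>e3\<close> is vacuous: no singleton is disjoint from
    itself.\<close>
  qed simp_all
  moreover have "{..n} \<subseteq> {n} \<union> {0..<n}" by auto
  \<comment> \<open>For \<open>n = 0\<close> the right side would be empty and the atom would hold
    under \<open>?R\<close>.\<close>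
  ultimately show False using assms by simp
qed

text \<open>The countermodel's values at \<open>0, ..., n - 1\<close> form the sequence, and
  \<open>s n\<close> is the point depending on all of them jointly.\<close>

lemma federated_if_complete:
  assumes "AIRAIndL_complete M ind"
  shows "federated M ind"
  unfolding federated_def
proof (intro allI impI)
  fix n :: nat assume "1 \<le> n"
  from countermodel_if_complete[OF assms federation_atoms_not_derives[OF this]]
  obtain s where s: "range s \<subseteq> universe M"
    and sat: "\<forall>\<psi>\<in>federation_atoms n. satisfies ind s \<psi>"
    and nsat: "\<not> satisfies ind s ([n] \<bottom> [0..<n])"
    by blast
  have seq: "ind (s ` {..<j}) {} {s j}" if "j < n" for j
  proof -
    have "([0..<j] \<bottom> [j]) \<in> federation_atoms n"
      using that unfolding federation_atoms_def by blast
    from bspec[OF sat this] show ?thesis by (simp add: atLeast0LessThan)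
  qed
  have proper: "ind {s n} {} (s ` ({..<n} - {j}))" if "j < n" for j
  proof -
    have "([n] \<bottom> filter (\<lambda>i. i \<noteq> j) [0..<n]) \<in> federation_atoms n"
      using that unfolding federation_atoms_def by blast
    from bspec[OF sat this] have "ind {s n} {} (s ` {i. i < n \<and> i \<noteq> j})" by simp
    moreover have "{i. i < n \<and> i \<noteq> j} = {..<n} - {j}" by auto
    ultimately show ?thesis by simp
  qed
  have dep: "\<not> ind {s n} {} (s ` {..<n})"
    using nsat by (simp add: atLeast0LessThan)
  have "inj_on s {..<n}"
  proof (rule inj_onI, rule ccontr)
    fix i j assume ij: "i \<in> {..<n}" "j \<in> {..<n}" "s i = s j" "i \<noteq> j"
    then have "s j \<in> s ` ({..<n} - {j})" by (metis Diff_iff imageI singletonD)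
    then have "s ` ({..<n} - {j}) = s ` {..<n}" by blast
    with proper[of j] dep ij(2) show False by simp
  qed
  with s seq proper dep have "federated_seq M ind n s"
    unfolding federated_seq_def independent_seq_def by blast
  then show "\<exists>a. federated_seq M ind n a" by blast
qed

text \<open>Without an algebraic point, \<open>[0] \<bottom> [0]\<close> would be unsatisfiable and
  would entail every atom, including an underivable one.\<close>

lemma algebraic_point_if_complete:
  assumes "AIRAIndL_complete M ind"
  shows "\<exists>e. algebraic_point M ind e"
proof -
  have "\<not> {[0] \<bottom> [0]} \<turnstile> [1] \<bottom> [1]"
    by (rule algebraic_variable_not_derives) simp
  then obtain s where s: "range s \<subseteq> universe M"
    and sat: "\<forall>\<psi>\<in>{[0] \<bottom> [0]}. satisfies ind s \<psi>"
    by (rule countermodel_if_complete[OF assms]) (rule that)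
  from sat have "ind {s 0} {} {s 0}" by simp
  with s show ?thesis
    unfolding algebraic_point_def by blast
qed

theorem theorem4p6:
  fixes \<tau> :: "('f, 'r) vocabulary"
    and K :: "('f, 'r, 'a) struct set"
    and le :: "('f, 'r, 'a) struct \<Rightarrow> ('f, 'r, 'a) struct \<Rightarrow> bool"
    and \<kappa> :: "'a rel"
    and M :: "('f, 'r, 'a) struct"
    and ind :: "'a set \<Rightarrow> 'a set \<Rightarrow> 'a set \<Rightarrow> bool"
  assumes "AEC \<tau> K le"
    and "amalgamation \<tau> K le"
    and "joint_embedding \<tau> K le"
    and "arbitrarily_large_models K"
    and "monster_model \<tau> K le \<kappa> M"
    and "pre_independence \<tau> \<kappa> M ind"
    and "AIRAIndL_complete M ind"
  shows "federated M ind \<and> (\<exists>e. algebraic_point M ind e)"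
  by (intro conjI federated_if_complete algebraic_point_if_complete assms(7))

end
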